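(* Let $H$ be a finite-dimensional pointed Hopf algebra over a field of characteristic $p>0$, with coradical filtration $\{H_m\}_{m\ge 0}$. Assume $H=H_n$ for some positive integer $n$, and let $d=\exp(H_0)<\infty$. Then $$\exp(H)\le d\,p^{\lfloor \log_p n\rfloor+1}.$$
   Context: For a bialgebra $B$ over a field and $n\ge1$, the $n$th Hopf power of $h\in B$ is $h^{[n]}=\sum h_{(1)}h_{(2)}\cdots h_{(n)}$. The exponent $\exp(B)$ is the least positive integer $n$ such that $h^{[n]}=\varepsilon(h)1$ for all $h\in B$, and $\exp(B)=\infty$ if no such $n$ exists. For a pointed Hopf algebra $H$, the coradical $H_0$ is the group algebra of the group $G(H)$ of group-like elements; it is a Hopf subalgebra, and when $H$ is finite-dimensional $\exp(H_0)$ is finite. $\lfloor\cdot\rfloor$ is the floor function. *)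

theory Defs
  imports Complex_Main "HOL-Library.Poly_Mapping" "HOL-Library.Extended_Nat"
begin

definition free_scale :: "'k::field \<Rightarrow> ('a \<Rightarrow>\<^sub>0 'k) \<Rightarrow> ('a \<Rightarrow>\<^sub>0 'k)"
  where "free_scale c x = Poly_Mapping.map ((*) c) x"

lemma lookup_free_scale: "Poly_Mapping.lookup (free_scale c x) p = c * Poly_Mapping.lookup x p"
  by (simp add: free_scale_def Poly_Mapping.map.rep_eq when_def)

interpretation free: vector_space "free_scale :: 'k::field \<Rightarrow> ('a \<Rightarrow>\<^sub>0 'k) \<Rightarrow> ('a \<Rightarrow>\<^sub>0 'k)"
  by unfold_locales
    (auto intro!: poly_mapping_eqI simp: lookup_free_scale lookup_add algebra_simps)

abbreviation gen :: "'a \<Rightarrow> ('a \<Rightarrow>\<^sub>0 'k::field)"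
  where "gen p \<equiv> Poly_Mapping.single p 1"

text \<open>The linear extension of a map \<open>B\<close>, defined on generators, to the free vector space;
  \<open>s\<close> is the scalar multiplication of the target.\<close>

definition lin_ext :: "('k::field \<Rightarrow> 'v \<Rightarrow> 'v) \<Rightarrow> ('a \<Rightarrow> 'v) \<Rightarrow> ('a \<Rightarrow>\<^sub>0 'k) \<Rightarrow> 'v::ab_group_add"
  where "lin_ext s B x = (\<Sum>p\<in>Poly_Mapping.keys x. s (Poly_Mapping.lookup x p) (B p))"

text \<open>The tensor products \<open>V \<otimes> V\<close> and \<open>V \<otimes> V \<otimes> V\<close> are the free vector spaces on
  \<open>V \<times> V\<close> and \<open>V \<times> V \<times> V\<close> modulo the (multi)linearity relations. Their elements are the
  cosets; \<open>rep t\<close> is some formal sum of pure tensors representing \<open>t\<close>.\<close>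

definition rep :: "('a \<Rightarrow>\<^sub>0 'k::field) set \<Rightarrow> ('a \<Rightarrow>\<^sub>0 'k)"
  where "rep t = (SOME x. x \<in> t)"

text \<open>A separate locale, so that these definitions are not instantiated in the existing
  interpretations of \<open>vector_space\<close>.\<close>

locale tensor_vector_space = vector_space scale
  for scale :: "'a::field \<Rightarrow> 'b::ab_group_add \<Rightarrow> 'b"
begin

definition tensor_null :: "('b \<times> 'b \<Rightarrow>\<^sub>0 'a) set"
  where "tensor_null = free.span
     ({gen (u + u', v) - gen (u, v) - gen (u', v) | u u' v. True} \<union>
      {gen (u, v + v') - gen (u, v) - gen (u, v') | u v v'. True} \<union>
      {gen (scale c u, v) - free_scale c (gen (u, v)) | c u v. True} \<union>
      {gen (u, scale c v) - free_scale c (gen (u, v)) | c u v. True})"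

definition tensor3_null :: "('b \<times> 'b \<times> 'b \<Rightarrow>\<^sub>0 'a) set"
  where "tensor3_null = free.span
     ({gen (u + u', v, w) - gen (u, v, w) - gen (u', v, w) | u u' v w. True} \<union>
      {gen (u, v + v', w) - gen (u, v, w) - gen (u, v', w) | u v v' w. True} \<union>
      {gen (u, v, w + w') - gen (u, v, w) - gen (u, v, w') | u v w w'. True} \<union>
      {gen (scale c u, v, w) - free_scale c (gen (u, v, w)) | c u v w. True} \<union>
      {gen (u, scale c v, w) - free_scale c (gen (u, v, w)) | c u v w. True} \<union>
      {gen (u, v, scale c w) - free_scale c (gen (u, v, w)) | c u v w. True})"

definition tensor :: "('b \<times> 'b \<Rightarrow>\<^sub>0 'a) \<Rightarrow> ('b \<times> 'b \<Rightarrow>\<^sub>0 'a) set"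
  where "tensor x = {y. y - x \<in> tensor_null}"

definition tensor3 :: "('b \<times> 'b \<times> 'b \<Rightarrow>\<^sub>0 'a) \<Rightarrow> ('b \<times> 'b \<times> 'b \<Rightarrow>\<^sub>0 'a) set"
  where "tensor3 x = {y. y - x \<in> tensor3_null}"

definition tensor_add ::
    "('b \<times> 'b \<Rightarrow>\<^sub>0 'a) set \<Rightarrow> ('b \<times> 'b \<Rightarrow>\<^sub>0 'a) set \<Rightarrow> ('b \<times> 'b \<Rightarrow>\<^sub>0 'a) set"
  where "tensor_add s t = tensor (rep s + rep t)"

definition tensor_scale :: "'a \<Rightarrow> ('b \<times> 'b \<Rightarrow>\<^sub>0 'a) set \<Rightarrow> ('b \<times> 'b \<Rightarrow>\<^sub>0 'a) set"
  where "tensor_scale c t = tensor (free_scale c (rep t))"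

text \<open>For subspaces \<open>U\<close> and \<open>W\<close> of \<open>V\<close>: the subspace \<open>U \<otimes> W\<close> of \<open>V \<otimes> V\<close>.\<close>

definition subspace_tensor :: "'b set \<Rightarrow> 'b set \<Rightarrow> ('b \<times> 'b \<Rightarrow>\<^sub>0 'a) set set"
  where "subspace_tensor U W = tensor ` free.span (gen ` (U \<times> W))"

definition tensor_subspace_sum ::
    "('b \<times> 'b \<Rightarrow>\<^sub>0 'a) set set \<Rightarrow> ('b \<times> 'b \<Rightarrow>\<^sub>0 'a) set set \<Rightarrow> ('b \<times> 'b \<Rightarrow>\<^sub>0 'a) set set"
  where "tensor_subspace_sum X Y = {tensor_add s t | s t. s \<in> X \<and> t \<in> Y}"

definition finite_dimensional :: bool
  where "finite_dimensional \<longleftrightarrow> (\<exists>B. finite B \<and> span B = UNIV)"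

end

text \<open>Writing \<open>rep (\<Delta> h)\<close> for \<open>\<Sum> h\<^sub>1 \<otimes> h\<^sub>2\<close>, a Sweedler sum \<open>\<Sum> B h\<^sub>1 h\<^sub>2\<close> with \<open>B\<close> bilinear
  is \<open>lin_ext s (\<lambda>(x, y). B x y) (rep (\<Delta> h))\<close>; it does not depend on the representative.\<close>

locale coalgebra = tensor_vector_space scale
  for scale :: "'k::field \<Rightarrow> 'h::ab_group_add \<Rightarrow> 'h" (infixr \<open>*s\<close> 75) +
  fixes \<Delta> :: "'h \<Rightarrow> ('h \<times> 'h \<Rightarrow>\<^sub>0 'k) set" and \<epsilon> :: "'h \<Rightarrow> 'k"
  assumes comult_tensor: "\<Delta> h \<in> range tensor"
    and comult_add: "\<Delta> (g + h) = tensor_add (\<Delta> g) (\<Delta> h)"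
    and comult_scale: "\<Delta> (c *s h) = tensor_scale c (\<Delta> h)"
    and counit_linear: "Vector_Spaces.linear scale (*) \<epsilon>"
    and coassoc:
      "tensor3 (lin_ext free_scale
         (\<lambda>(x, y). lin_ext free_scale (\<lambda>(u, v). gen (u, v, y)) (rep (\<Delta> x))) (rep (\<Delta> h))) =
       tensor3 (lin_ext free_scale
         (\<lambda>(x, y). lin_ext free_scale (\<lambda>(u, v). gen (x, u, v)) (rep (\<Delta> y))) (rep (\<Delta> h)))"
    and counit_left: "lin_ext scale (\<lambda>(x, y). \<epsilon> x *s y) (rep (\<Delta> h)) = h"
    and counit_right: "lin_ext scale (\<lambda>(x, y). \<epsilon> y *s x) (rep (\<Delta> h)) = h"
begin

definition subcoalgebra :: "'h set \<Rightarrow> bool"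
  where "subcoalgebra D \<longleftrightarrow> subspace D \<and> (\<forall>x\<in>D. \<Delta> x \<in> subspace_tensor D D)"

definition simple_subcoalgebra :: "'h set \<Rightarrow> bool"
  where "simple_subcoalgebra D \<longleftrightarrow> subcoalgebra D \<and> D \<noteq> {0} \<and>
    (\<forall>E. subcoalgebra E \<and> E \<subseteq> D \<longrightarrow> E = {0} \<or> E = D)"

definition coradical :: "'h set"
  where "coradical = span (\<Union> {D. simple_subcoalgebra D})"

definition pointed :: bool
  where "pointed \<longleftrightarrow> (\<forall>D. simple_subcoalgebra D \<longrightarrow> dim D = 1)"

text \<open>\<open>C\<^sub>0\<close> is the coradical and \<open>C\<^sub>m\<^sub>+\<^sub>1 = \<Delta>\<^sup>-\<^sup>1(C \<otimes> C\<^sub>m + C\<^sub>0 \<otimes> C)\<close>.\<close>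

primrec coradical_filtration :: "nat \<Rightarrow> 'h set" where
  "coradical_filtration 0 = coradical"
| "coradical_filtration (Suc m) =
    {h. \<Delta> h \<in> tensor_subspace_sum (subspace_tensor UNIV (coradical_filtration m))
                                 (subspace_tensor coradical UNIV)}"

end

locale algebra_over_field = vector_space scale
  for scale :: "'k::field \<Rightarrow> 'h::ring_1 \<Rightarrow> 'h" (infixr \<open>*s\<close> 75) +
  assumes scale_mult_left: "(c *s x) * y = c *s (x * y)"
    and scale_mult_right: "x * (c *s y) = c *s (x * y)"

locale bialgebra = algebra_over_field scale + coalgebra scale \<Delta> \<epsilon>
  for scale :: "'k::field \<Rightarrow> 'h::ring_1 \<Rightarrow> 'h" (infixr \<open>*s\<close> 75)
    and \<Delta> :: "'h \<Rightarrow> ('h \<times> 'h \<Rightarrow>\<^sub>0 'k) set" and \<epsilon> :: "'h \<Rightarrow> 'k" +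
  assumes comult_mult:
      "\<Delta> (g * h) = tensor (lin_ext free_scale
         (\<lambda>(x, y). lin_ext free_scale (\<lambda>(u, v). gen (x * u, y * v)) (rep (\<Delta> h))) (rep (\<Delta> g)))"
    and comult_one: "\<Delta> 1 = tensor (gen (1, 1))"
    and counit_mult: "\<epsilon> (g * h) = \<epsilon> g * \<epsilon> h"
    and counit_one: "\<epsilon> 1 = 1"
begin

text \<open>\<open>h\<^sup>[\<^sup>n\<^sup>] = \<Sum> h\<^sub>1 h\<^sub>2 \<dots> h\<^sub>n\<close>, by the recursion \<open>h\<^sup>[\<^sup>n\<^sup>+\<^sup>1\<^sup>] = \<Sum> h\<^sub>1 (h\<^sub>2)\<^sup>[\<^sup>n\<^sup>]\<close>.\<close>

primrec hopf_power :: "nat \<Rightarrow> 'h \<Rightarrow> 'h" where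
  "hopf_power 0 h = \<epsilon> h *s 1"
| "hopf_power (Suc n) h = lin_ext scale (\<lambda>(x, y). x * hopf_power n y) (rep (\<Delta> h))"

lemma hopf_power_1: "hopf_power (Suc 0) h = h"
  by (simp add: scale_mult_right counit_right)

text \<open>The exponent of a sub-bialgebra \<open>B\<close>, whose Hopf powers are computed in the ambient
  bialgebra.\<close>

definition exponent :: "'h set \<Rightarrow> enat"
  where "exponent B =
    (if \<exists>n>0. \<forall>h\<in>B. hopf_power n h = \<epsilon> h *s 1
     then enat (LEAST n. n > 0 \<and> (\<forall>h\<in>B. hopf_power n h = \<epsilon> h *s 1))
     else \<infinity>)"

end

locale hopf_algebra = bialgebra scale \<Delta> \<epsilon>
  for scale :: "'k::field \<Rightarrow> 'h::ring_1 \<Rightarrow> 'h" (infixr \<open>*s\<close> 75)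
    and \<Delta> :: "'h \<Rightarrow> ('h \<times> 'h \<Rightarrow>\<^sub>0 'k) set" and \<epsilon> :: "'h \<Rightarrow> 'k" +
  fixes S :: "'h \<Rightarrow> 'h"
  assumes antipode_linear: "Vector_Spaces.linear scale scale S"
    and antipode_left: "lin_ext scale (\<lambda>(x, y). S x * y) (rep (\<Delta> h)) = \<epsilon> h *s 1"
    and antipode_right: "lin_ext scale (\<lambda>(x, y). x * S y) (rep (\<Delta> h)) = \<epsilon> h *s 1"

end

theory Submission
  imports Defs "HOL-Computational_Algebra.Primes"
begin

text \<open>
  The \<open>n\<close>th Hopf power is the \<open>n\<close>th convolution power of the identity. Let \<open>u h = \<epsilon> h 1\<close> be the
  unit of the convolution algebra and \<open>f = id\<^sup>d - u\<close>, which vanishes on \<open>H\<^sub>0\<close>. Since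
  \<open>\<Delta>(H\<^sub>m\<^sub>+\<^sub>1) \<subseteq> H \<otimes> H\<^sub>m + H\<^sub>0 \<otimes> H\<close>, induction on \<open>m\<close> shows that the power \<open>f\<^sup>m\<^sup>+\<^sup>1\<close> vanishes on
  \<open>H\<^sub>m\<close>. So \<open>f\<^sup>q = 0\<close> for every power \<open>q > n\<close> of \<open>p\<close>, and in characteristic \<open>p\<close> the binomial
  theorem gives \<open>id\<^sup>d\<^sup>q = (u + f)\<^sup>q = u + f\<^sup>q = u\<close>.

  The exponent \<open>d\<close> of \<open>H\<^sub>0\<close> is finite: pointedness makes \<open>H\<^sub>0\<close> the span of the group-like elements,
  which are linearly independent, hence finite in number and of finite order.
\<close>

section \<open>Linear extensions and tensors\<close>

text \<open>Padding with zero coefficients lets formal sums with different supports be compared over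
  one common finite index set.\<close>

lemma lin_ext_superset:
  assumes "vector_space s" "finite A" "Poly_Mapping.keys x \<subseteq> A"
  shows "lin_ext s B x = (\<Sum>p\<in>A. s (Poly_Mapping.lookup x p) (B p))"
proof -
  interpret t: vector_space s by fact
  show ?thesis unfolding lin_ext_def
    by (rule sum.mono_neutral_left) (use assms in \<open>auto simp: in_keys_iff\<close>)
qed

lemma linear_lin_ext:
  assumes "vector_space s"
  shows "Vector_Spaces.linear free_scale s (lin_ext s B)"
proof -
  interpret t: vector_space s by fact
  have "lin_ext s B (x + y) = lin_ext s B x + lin_ext s B y" for x y
  proof -
    define A where "A = Poly_Mapping.keys x \<union> Poly_Mapping.keys y"
    have "finite A" "Poly_Mapping.keys x \<subseteq> A" "Poly_Mapping.keys y \<subseteq> A" "Poly_Mapping.keys (x + y) \<subseteq> A"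
      using Poly_Mapping.keys_add[of x y] by (auto simp: A_def)
    then show ?thesis
      by (simp add: lin_ext_superset[OF assms, of A] lookup_add t.scale_left_distrib sum.distrib)
  qed
  moreover have "lin_ext s B (free_scale c x) = s c (lin_ext s B x)" for c x
  proof -
    have "Poly_Mapping.keys (free_scale c x) \<subseteq> Poly_Mapping.keys x"
      by (auto simp: in_keys_iff lookup_free_scale)
    then show ?thesis
      by (simp add: lin_ext_superset[OF assms, of "Poly_Mapping.keys x"] lookup_free_scale
          t.scale_sum_right)
  qed
  ultimately show ?thesis
    using assms free.vector_space_axioms by (auto simp: Vector_Spaces.linear_iff)
qed

lemma lin_ext_add: "vector_space s \<Longrightarrow> lin_ext s B (x + y) = lin_ext s B x + lin_ext s B y"
  using linear_lin_ext[of s B] by (simp add: Vector_Spaces.linear_iff)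

lemma lin_ext_scale: "vector_space s \<Longrightarrow> lin_ext s B (free_scale c x) = s c (lin_ext s B x)"
  using linear_lin_ext[of s B] by (simp add: Vector_Spaces.linear_iff)

lemma lin_ext_diff: "vector_space s \<Longrightarrow> lin_ext s B (x - y) = lin_ext s B x - lin_ext s B y"
  using lin_ext_add[of s B "x - y" y] by simp

lemma lin_ext_gen:
  assumes "vector_space s" shows "lin_ext s B (gen p) = B p"
proof -
  interpret t: vector_space s by fact
  show ?thesis by (simp add: lin_ext_def)
qed

lemma linear_image_lin_ext:
  assumes "Vector_Spaces.linear s t F"
  shows "F (lin_ext s B x) = lin_ext t (\<lambda>p. F (B p)) x"
proof -
  interpret F: Vector_Spaces.linear s t F by fact
  show ?thesis by (simp add: lin_ext_def F.sum F.scale)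
qed

lemma lin_ext_compose:
  assumes "vector_space s"
  shows "lin_ext s F (lin_ext free_scale B x) = lin_ext s (\<lambda>p. lin_ext s F (B p)) x"
  by (rule linear_image_lin_ext) (rule linear_lin_ext[OF assms])

lemma lin_ext_add_fun:
  assumes "vector_space s"
  shows "lin_ext s (\<lambda>p. B p + C p) x = lin_ext s B x + lin_ext s C x"
proof -
  interpret t: vector_space s by fact
  show ?thesis by (simp add: lin_ext_def t.scale_right_distrib sum.distrib)
qed

text \<open>Serves the nested formal sum in \<open>comult_mult\<close>: the inner sums may be
  replaced by congruent ones modulo \<open>tensor_null\<close>.\<close>

lemma lin_ext_diff_fun_mem:
  assumes "module.subspace s N" "vector_space s" "\<And>p. B p - C p \<in> N"
  shows "lin_ext s B x - lin_ext s C x \<in> N"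
proof -
  interpret t: vector_space s by fact
  have "lin_ext s B x - lin_ext s C x =
      (\<Sum>p\<in>Poly_Mapping.keys x. s (Poly_Mapping.lookup x p) (B p - C p))"
    by (simp add: lin_ext_def t.scale_right_diff_distrib sum_subtractf)
  then show ?thesis
    using assms(1,3) by (simp add: t.subspace_sum t.subspace_scale)
qed

lemma linear_vanishes_on_span:
  assumes "Vector_Spaces.linear s t F" "x \<in> module.span s X" "\<And>y. y \<in> X \<Longrightarrow> F y = 0"
  shows "F x = 0"
proof -
  interpret F: Vector_Spaces.linear s t F by fact
  show ?thesis using F.eq_0_on_span[OF assms(3,2)] .
qed

lemma lin_ext_vanishes_on_span:
  assumes "vector_space s" "x \<in> free.span (gen ` X)" "\<And>p. p \<in> X \<Longrightarrow> B p = 0"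
  shows "lin_ext s B x = 0"
  by (rule linear_vanishes_on_span[OF linear_lin_ext[OF assms(1)] assms(2)])
    (auto simp: lin_ext_gen assms(1,3))

section \<open>Bilinear maps on the quotient tensor product\<close>

context tensor_vector_space
begin

text \<open>The case \<open>N = tensor_null\<close> treats tensor-valued bilinear maps on the level of formal sums.\<close>

definition bilinear_mod :: "('a \<Rightarrow> 'v \<Rightarrow> 'v) \<Rightarrow> 'v set \<Rightarrow> ('b \<Rightarrow> 'b \<Rightarrow> 'v::ab_group_add) \<Rightarrow> bool"
  where "bilinear_mod s N B \<longleftrightarrow>
    (\<forall>u u' v. B (u + u') v - B u v - B u' v \<in> N) \<and>
    (\<forall>u v v'. B u (v + v') - B u v - B u v' \<in> N) \<and>
    (\<forall>c u v. B (scale c u) v - s c (B u v) \<in> N) \<and>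
    (\<forall>c u v. B u (scale c v) - s c (B u v) \<in> N)"

abbreviation bilinear :: "('a \<Rightarrow> 'v \<Rightarrow> 'v) \<Rightarrow> ('b \<Rightarrow> 'b \<Rightarrow> 'v::ab_group_add) \<Rightarrow> bool"
  where "bilinear s B \<equiv> bilinear_mod s {0} B"

text \<open>Universal property of the tensor product, modulo \<open>N\<close>: the preimage of
  \<open>N\<close> under the linear extension is a subspace, and bilinearity modulo \<open>N\<close>
  puts every defining relation into it.\<close>

lemma lin_ext_tensor_null:
  assumes "vector_space s" "module.subspace s N" "bilinear_mod s N B" "x \<in> tensor_null"
  shows "lin_ext s (\<lambda>(u, v). B u v) x \<in> N"
proof -
  interpret t: vector_space s by fact
  note L = lin_ext_gen[OF assms(1)] lin_ext_diff[OF assms(1)] lin_ext_scale[OF assms(1)]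
    lin_ext_add[OF assms(1)]
  have "free.subspace {x. lin_ext s (\<lambda>(u, v). B u v) x \<in> N}"
    using assms(2) unfolding free.subspace_def
    by (auto simp: L t.subspace_add t.subspace_scale lin_ext_def[of _ _ 0] t.subspace_0)
  then have "tensor_null \<subseteq> {x. lin_ext s (\<lambda>(u, v). B u v) x \<in> N}"
    unfolding tensor_null_def
    by (intro free.span_minimal) (use assms(3) in \<open>auto simp: L bilinear_mod_def\<close>)
  then show ?thesis using assms(4) by blast
qed

lemma subspace_tensor_null: "free.subspace tensor_null"
  by (simp add: tensor_null_def)

lemma tensor_eq_iff: "tensor x = tensor y \<longleftrightarrow> x - y \<in> tensor_null"
proof
  assume "tensor x = tensor y"
  moreover have "x \<in> tensor x"
    by (simp add: tensor_def free.subspace_0[OF subspace_tensor_null])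
  ultimately show "x - y \<in> tensor_null" by (auto simp: tensor_def)
next
  assume *: "x - y \<in> tensor_null"
  have "z - x \<in> tensor_null \<longleftrightarrow> z - y \<in> tensor_null" for z
    using free.subspace_add[OF subspace_tensor_null _ *, of "z - x"]
      free.subspace_diff[OF subspace_tensor_null _ *, of "z - y"]
    by auto
  then show "tensor x = tensor y" by (auto simp: tensor_def)
qed

lemma tensor_rep: "t \<in> range tensor \<Longrightarrow> tensor (rep t) = t"
proof -
  assume "t \<in> range tensor"
  then obtain x where t: "t = tensor x" by blast
  have "x \<in> t"
    by (simp add: t tensor_def free.subspace_0[OF subspace_tensor_null])
  then have "rep t \<in> t" unfolding rep_def by (rule someI)
  then show ?thesis using tensor_eq_iff t by (simp add: tensor_def)
qed

lemma rep_tensor_diff: "rep (tensor x) - x \<in> tensor_null"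
  using tensor_rep[of "tensor x"] tensor_eq_iff by blast

text \<open>This makes Sweedler sums independent of the arbitrary choice made by
  \<open>rep\<close>.\<close>

lemma lin_ext_cong_tensor:
  assumes "vector_space s" "bilinear s B" "tensor x = tensor y"
  shows "lin_ext s (\<lambda>(u, v). B u v) x = lin_ext s (\<lambda>(u, v). B u v) y"
proof -
  interpret t: vector_space s by fact
  have "x - y \<in> tensor_null" using assms(3) tensor_eq_iff by blast
  from lin_ext_tensor_null[OF assms(1) _ assms(2) this] show ?thesis
    by (simp add: lin_ext_diff[OF assms(1)])
qed

text \<open>Trilinear counterpart, through which coassociativity reaches the convolution
  product.\<close>

lemma lin_ext_tensor3_null:
  assumes "vector_space s"
    and add: "\<And>u u' v w. T (u + u') v w = T u v w + T u' v w"
      "\<And>u v v' w. T u (v + v') w = T u v w + T u v' w"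
      "\<And>u v w w'. T u v (w + w') = T u v w + T u v w'"
    and scale: "\<And>c u v w. T (scale c u) v w = s c (T u v w)"
      "\<And>c u v w. T u (scale c v) w = s c (T u v w)"
      "\<And>c u v w. T u v (scale c w) = s c (T u v w)"
    and x: "x \<in> tensor3_null"
  shows "lin_ext s (\<lambda>(u, v, w). T u v w) x = 0"
  by (rule linear_vanishes_on_span[OF linear_lin_ext[OF assms(1)] x[unfolded tensor3_null_def]])
    (auto simp: add scale lin_ext_gen[OF assms(1)] lin_ext_diff[OF assms(1)]
      lin_ext_scale[OF assms(1)])

lemma tensor3_eq_imp: "tensor3 x = tensor3 y \<Longrightarrow> x - y \<in> tensor3_null"
proof -
  assume "tensor3 x = tensor3 y"
  moreover have "x \<in> tensor3 x"
    by (simp add: tensor3_def tensor3_null_def free.span_zero)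
  ultimately show "x - y \<in> tensor3_null" by (auto simp: tensor3_def)
qed

end

section \<open>Sweedler sums\<close>

context coalgebra
begin

definition sweedler :: "('k \<Rightarrow> 'v \<Rightarrow> 'v) \<Rightarrow> ('h \<Rightarrow> 'h \<Rightarrow> 'v::ab_group_add) \<Rightarrow> 'h \<Rightarrow> 'v"
  where "sweedler s B h = lin_ext s (\<lambda>(x, y). B x y) (rep (\<Delta> h))"

text \<open>Allows a Sweedler sum to be computed from whichever representative of
  \<open>\<Delta> h\<close> is convenient.\<close>

lemma sweedler_tensor:
  assumes "vector_space s" "bilinear s B" "\<Delta> h = tensor x"
  shows "sweedler s B h = lin_ext s (\<lambda>(u, v). B u v) x"
  unfolding sweedler_def
  by (rule lin_ext_cong_tensor[OF assms(1,2)]) (metis tensor_rep comult_tensor assms(3))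

lemma linear_sweedler:
  assumes "vector_space s" "bilinear s B"
  shows "Vector_Spaces.linear scale s (sweedler s B)"
proof -
  have "sweedler s B (g + h) = sweedler s B g + sweedler s B h" for g h
    using sweedler_tensor[OF assms, of "g + h" "rep (\<Delta> g) + rep (\<Delta> h)"]
    by (simp add: comult_add tensor_add_def sweedler_def lin_ext_add[OF assms(1)])
  moreover have "sweedler s B (c *s h) = s c (sweedler s B h)" for c h
    using sweedler_tensor[OF assms, of "c *s h" "free_scale c (rep (\<Delta> h))"]
    by (simp add: comult_scale tensor_scale_def sweedler_def lin_ext_scale[OF assms(1)])
  ultimately show ?thesis
    using assms(1) vector_space_axioms by (simp add: Vector_Spaces.linear_iff)
qed

lemma counit_add: "\<epsilon> (g + h) = \<epsilon> g + \<epsilon> h"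
  and counit_scale: "\<epsilon> (c *s h) = c * \<epsilon> h"
  using counit_linear by (simp_all add: Vector_Spaces.linear_iff)

text \<open>By definition of the filtration, \<open>\<Delta> h\<close> is a sum of a tensor with
  right factors in \<open>coradical_filtration m\<close> and one with left factors in the coradical;
  \<open>B\<close> kills both.\<close>

lemma sweedler_vanishes_on_filtration:
  assumes "vector_space s" "bilinear s B"
    and "h \<in> coradical_filtration (Suc m)"
    and left: "\<And>x y. x \<in> coradical \<Longrightarrow> B x y = 0"
    and right: "\<And>x y. y \<in> coradical_filtration m \<Longrightarrow> B x y = 0"
  shows "sweedler s B h = 0"
proof -
  let ?L = "lin_ext s (\<lambda>(u, v). B u v)"
  obtain a b where ab: "\<Delta> h = tensor (rep (tensor a) + rep (tensor b))"
    and a: "a \<in> free.span (gen ` (UNIV \<times> coradical_filtration m))"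
    and b: "b \<in> free.span (gen ` (coradical \<times> UNIV))"
    using assms(3) by (auto simp: tensor_subspace_sum_def subspace_tensor_def tensor_add_def)
  \<comment> \<open>\<open>tensor_add\<close> works with chosen representatives of the two cosets,
    so these must be traded for \<open>a\<close> and \<open>b\<close>, whose supports are
    controlled.\<close>
  have rep: "?L (rep (tensor x)) = ?L x" for x
    by (rule lin_ext_cong_tensor[OF assms(1,2)]) (simp add: tensor_rep)
  have "?L a = 0"
    by (rule lin_ext_vanishes_on_span[OF assms(1) a]) (auto simp: right)
  moreover have "?L b = 0"
    by (rule lin_ext_vanishes_on_span[OF assms(1) b]) (auto simp: left)
  ultimately show ?thesis
    using sweedler_tensor[OF assms(1,2) ab] by (simp add: lin_ext_add[OF assms(1)] rep)
qed

section \<open>Group-like elements\<close>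

text \<open>The counit condition excludes zero, which also satisfies the second equation.\<close>

definition grouplike :: "'h \<Rightarrow> bool"
  where "grouplike g \<longleftrightarrow> \<epsilon> g = 1 \<and> \<Delta> g = tensor (gen (g, g))"

lemma sweedler_grouplike:
  assumes "vector_space s" "bilinear s B" "grouplike g"
  shows "sweedler s B g = B g g"
  using assms sweedler_tensor[OF assms(1,2), of g "gen (g, g)"]
  by (simp add: grouplike_def lin_ext_gen)

text \<open>A maximal independent set \<open>B\<close> of group-likes is finite and already contains
  all of them. If \<open>g\<close> has coordinates \<open>a\<close> over \<open>B\<close>, comparing
  coefficients in \<open>\<Delta> g\<close> shows that only one coordinate is nonzero, and the
  counit shows that it is 1.\<close>

lemma grouplikes_finite:
  assumes "finite_dimensional"
  shows "finite {g. grouplike g}"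
proof -
  have K: "vector_space ((*) :: 'k \<Rightarrow> 'k \<Rightarrow> 'k)"
    by unfold_locales (simp_all add: algebra_simps)
  obtain B where B: "B \<subseteq> {g. grouplike g}" "independent B" "{g. grouplike g} \<subseteq> span B"
    using maximal_independent_subset by blast
  have finB: "finite B"
    using assms independent_span_bound[OF _ B(2)] by (auto simp: finite_dimensional_def)
  \<comment> \<open>Coordinate functionals must be linear on the whole space, hence the extension of
    \<open>B\<close> to a basis.\<close>
  define R where "R v b = representation (extend_basis B) v b" for v b
  note E = independent_extend_basis[OF B(2)] span_extend_basis[OF B(2)]
  have R_add: "R (u + v) b = R u b + R v b" and R_scale: "R (c *s v) b = c * R v b" for u v c b
    using E by (auto simp: R_def representation_add representation_scale)
  have R_basis: "R e b = (if b = e then 1 else 0)" if "e \<in> B" for e b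
    unfolding R_def
    by (subst representation_basis[OF E(1)]) (use that extend_basis_superset[OF B(2)] in auto)
  have "g \<in> B" if g: "grouplike g" for g
  proof -
    obtain a where a: "g = (\<Sum>b\<in>B. a b *s b)"
      using B(3) g span_finite[OF finB] by blast
    have Rg: "R g b = a b" if "b \<in> B" for b
    proof -
      have "R g b = (\<Sum>e\<in>B. a e * R e b)"
      proof -
        interpret Rl: Vector_Spaces.linear scale "(*)" "\<lambda>v. R v b"
          using vector_space_axioms K R_add R_scale
          by (simp add: Vector_Spaces.linear_iff)
        show ?thesis by (simp add: a Rl.sum Rl.scale)
      qed
      also have "\<dots> = (\<Sum>e\<in>B. if e = b then a e else 0)"
        by (rule sum.cong) (auto simp: R_basis)
      finally show ?thesis using that finB by simp
    qed
    have prod0: "a b * a c = 0" if bc: "b \<in> B" "c \<in> B" "b \<noteq> c" for b c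
    proof -
      \<comment> \<open>This form reads off the coefficient at the tensor of \<open>b\<close> and
        \<open>c\<close>. On \<open>g\<close> it gives \<open>a b * a c\<close>, since
        \<open>g\<close> is group-like; expanding \<open>g\<close> over \<open>B\<close> gives 0,
        since no \<open>e\<close> in \<open>B\<close> has nonzero coordinates at both
        \<open>b\<close> and \<open>c\<close>.\<close>
      let ?\<beta> = "\<lambda>x y. R x b * R y c"
      have bil: "bilinear (*) ?\<beta>"
        by (simp add: bilinear_mod_def R_add R_scale algebra_simps)
      interpret T: Vector_Spaces.linear scale "(*)" "sweedler (*) ?\<beta>"
        by (rule linear_sweedler[OF K bil])
      have "a b * a c = sweedler (*) ?\<beta> g"
        using sweedler_grouplike[OF K bil g] bc by (simp add: Rg)
      also have "\<dots> = (\<Sum>e\<in>B. a e * sweedler (*) ?\<beta> e)"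
        by (simp add: a T.sum T.scale)
      also have "\<dots> = 0"
      proof (rule sum.neutral, rule ballI)
        fix e assume "e \<in> B"
        then have "sweedler (*) ?\<beta> e = R e b * R e c"
          using B(1) by (intro sweedler_grouplike[OF K bil]) auto
        then show "a e * sweedler (*) ?\<beta> e = 0"
          using bc R_basis[OF \<open>e \<in> B\<close>] by auto
      qed
      finally show ?thesis .
    qed
    have "\<exists>b\<in>B. a b \<noteq> 0"
    proof (rule ccontr)
      assume "\<not> ?thesis"
      then have "g = 0" by (simp add: a)
      then show False using g counit_scale[of 0 0] by (simp add: grouplike_def)
    qed
    then obtain b where b: "b \<in> B" "a b \<noteq> 0" by blast
    \<comment> \<open>As \<open>a b\<close> is nonzero, \<open>prod0\<close> kills every other
      coefficient.\<close>
    have "g = (\<Sum>c\<in>B. if c = b then a c *s c else 0)"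
      unfolding a by (rule sum.cong) (use prod0 b in auto)
    then have gb: "g = a b *s b" using finB b by simp
    moreover have "a b = 1"
      using arg_cong[OF gb, of \<epsilon>] g b B(1) by (auto simp: counit_scale grouplike_def)
    ultimately show "g \<in> B" using b by simp
  qed
  then show ?thesis using finite_subset[OF _ finB] by blast
qed

text \<open>If \<open>x\<close> spans \<open>D\<close>, then \<open>\<Delta> x\<close> is
  \<open>c\<close> times the tensor of \<open>x\<close> with itself. The counit axiom gives
  \<open>c * \<epsilon> x = 1\<close>, and the rescaled vector \<open>c *s x\<close> is
  group-like.\<close>

lemma simple_subcoalgebra_subset_span_grouplike:
  assumes "simple_subcoalgebra D" "dim D = 1"
  shows "D \<subseteq> span {g. grouplike g}"
proof -
  have D: "subspace D" "\<And>x. x \<in> D \<Longrightarrow> \<Delta> x \<in> subspace_tensor D D"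
    using assms by (auto simp: simple_subcoalgebra_def subcoalgebra_def)
  obtain X where X: "X \<subseteq> D" "independent X" "D \<subseteq> span X" "card X = 1"
    using basis_exists[of D] assms(2) by metis
  then obtain x where x: "X = {x}" by (metis card_1_singletonE)
  have x0: "x \<noteq> 0" using X(2) x by auto
  have Dx: "\<exists>c. y = c *s x" if "y \<in> D" for y
    using X(3) that by (auto simp: x span_singleton)
  have scale2: "gen (a *s u, b *s v) - free_scale (a * b) (gen (u, v)) \<in> tensor_null" for a b u v
  proof -
    have 1: "gen (a *s u, b *s v) - free_scale a (gen (u, b *s v)) \<in> tensor_null"
      unfolding tensor_null_def by (rule free.span_base) blast
    have "gen (u, b *s v) - free_scale b (gen (u, v)) \<in> tensor_null"
      unfolding tensor_null_def by (rule free.span_base) blast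
    then have "free_scale a (gen (u, b *s v) - free_scale b (gen (u, v))) \<in> tensor_null"
      by (rule free.subspace_scale[OF subspace_tensor_null])
    from free.subspace_add[OF subspace_tensor_null 1 this] show ?thesis
      by (simp add: free.scale_right_diff_distrib)
  qed
  \<comment> \<open>The formal sums that represent a multiple of the tensor of \<open>x\<close> with
    itself; they form a subspace containing all generators over \<open>D\<close>.\<close>
  let ?P = "{z. \<exists>c. z - free_scale c (gen (x, x)) \<in> tensor_null}"
  have "free.subspace ?P"
    unfolding free.subspace_def
  proof (intro conjI ballI allI)
    show "0 \<in> ?P"
      using free.subspace_0[OF subspace_tensor_null] by (auto intro!: exI[of _ 0])
  next
    fix y z assume "y \<in> ?P" "z \<in> ?P"
    then obtain b c where "y - free_scale b (gen (x, x)) \<in> tensor_null"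
      "z - free_scale c (gen (x, x)) \<in> tensor_null" by blast
    from free.subspace_add[OF subspace_tensor_null this]
    show "y + z \<in> ?P"
      by (auto intro!: exI[of _ "b + c"] simp: free.scale_left_distrib algebra_simps)
  next
    fix c y assume "y \<in> ?P"
    then obtain b where "y - free_scale b (gen (x, x)) \<in> tensor_null" by blast
    from free.subspace_scale[OF subspace_tensor_null this, of c]
    show "free_scale c y \<in> ?P"
      by (auto intro!: exI[of _ "c * b"] simp: free.scale_right_diff_distrib)
  qed
  moreover have "gen (u, v) \<in> ?P" if "u \<in> D" "v \<in> D" for u v
    using Dx[OF that(1)] Dx[OF that(2)] scale2 by blast
  ultimately have span: "free.span (gen ` (D \<times> D)) \<subseteq> ?P"
    by (intro free.span_minimal) auto
  have "x \<in> D" using X x by blast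
  from D(2)[OF this] obtain z where "z \<in> free.span (gen ` (D \<times> D))" "\<Delta> x = tensor z"
    by (auto simp: subspace_tensor_def)
  with span obtain c where c: "\<Delta> x = tensor (free_scale c (gen (x, x)))"
    by (auto simp: tensor_eq_iff)
  have bil: "bilinear scale (\<lambda>x y. \<epsilon> x *s y)"
    by (simp add: bilinear_mod_def counit_add counit_scale algebra_simps
        scale_left_distrib scale_right_distrib)
  have "x = sweedler scale (\<lambda>x y. \<epsilon> x *s y) x"
    using counit_left[of x] by (simp add: sweedler_def)
  also have "\<dots> = (c * \<epsilon> x) *s x"
    by (simp add: sweedler_tensor[OF vector_space_axioms bil c]
        lin_ext_scale[OF vector_space_axioms] lin_ext_gen[OF vector_space_axioms])
  finally have "(c * \<epsilon> x - 1) *s x = 0" by (simp add: scale_left_diff_distrib)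
  then have c1: "c * \<epsilon> x = 1" using x0 by simp
  \<comment> \<open>Multiplying \<open>\<Delta> x\<close> by \<open>c\<close> produces the
    coefficient \<open>c * c\<close>, and one factor \<open>c\<close> is absorbed into each
    slot.\<close>
  have "rep (\<Delta> x) - free_scale c (gen (x, x)) \<in> tensor_null"
    unfolding c by (rule rep_tensor_diff)
  then have "free_scale c (rep (\<Delta> x)) - free_scale (c * c) (gen (x, x)) \<in> tensor_null"
    using free.subspace_scale[OF subspace_tensor_null, of _ c]
    by (fastforce simp: free.scale_right_diff_distrib)
  from free.subspace_diff[OF subspace_tensor_null this scale2[of c x c x]]
  have "\<Delta> (c *s x) = tensor (gen (c *s x, c *s x))"
    by (simp add: comult_scale tensor_scale_def tensor_eq_iff)
  then have "grouplike (c *s x)" using c1 by (simp add: grouplike_def counit_scale)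
  then have "c *s x \<in> span {g. grouplike g}" by (intro span_base) simp
  then have "inverse c *s c *s x \<in> span {g. grouplike g}" by (rule span_scale)
  moreover have "c \<noteq> 0" using c1 by auto
  ultimately have xs: "x \<in> span {g. grouplike g}" by simp
  show ?thesis using Dx xs span_scale by blast
qed

lemma pointed_coradical_subset_span_grouplike:
  assumes pointed
  shows "coradical \<subseteq> span {g. grouplike g}"
  unfolding coradical_def
  by (rule span_minimal)
    (use assms simple_subcoalgebra_subset_span_grouplike in \<open>auto simp: pointed_def\<close>)

end

section \<open>The convolution algebra\<close>

context bialgebra
begin

abbreviation endo :: "('h \<Rightarrow> 'h) \<Rightarrow> bool"
  where "endo f \<equiv> Vector_Spaces.linear scale scale f"

lemma endo_iff: "endo f \<longleftrightarrow> (\<forall>x y. f (x + y) = f x + f y) \<and> (\<forall>c x. f (c *s x) = c *s f x)"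
  using vector_space_axioms by (simp add: Vector_Spaces.linear_iff)

definition conv :: "('h \<Rightarrow> 'h) \<Rightarrow> ('h \<Rightarrow> 'h) \<Rightarrow> 'h \<Rightarrow> 'h"
  where "conv f g = sweedler scale (\<lambda>x y. f x * g y)"

primrec conv_pow :: "('h \<Rightarrow> 'h) \<Rightarrow> nat \<Rightarrow> 'h \<Rightarrow> 'h" where
  "conv_pow f 0 = (\<lambda>h. \<epsilon> h *s 1)"
| "conv_pow f (Suc n) = conv f (conv_pow f n)"

lemma hopf_power_eq_conv_pow: "hopf_power n h = conv_pow (\<lambda>x. x) n h"
  by (induction n arbitrary: h) (simp_all add: conv_def sweedler_def)

lemma bilinear_mult: "endo f \<Longrightarrow> endo g \<Longrightarrow> bilinear scale (\<lambda>x y. f x * g y)"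
  by (simp add: endo_iff bilinear_mod_def algebra_simps scale_mult_left scale_mult_right)

lemma endo_conv: "endo f \<Longrightarrow> endo g \<Longrightarrow> endo (conv f g)"
  unfolding conv_def by (intro linear_sweedler bilinear_mult vector_space_axioms)

lemma endo_unit: "endo (\<lambda>h. \<epsilon> h *s 1)"
  by (simp add: endo_iff counit_add counit_scale scale_left_distrib)

lemma endo_conv_pow: "endo f \<Longrightarrow> endo (conv_pow f n)"
  by (induction n) (simp_all add: endo_unit endo_conv)

lemma conv_unit_left:
  assumes "endo f" shows "conv (\<lambda>h. \<epsilon> h *s 1) f = f"
proof
  fix h
  have "f h = f (lin_ext scale (\<lambda>(x, y). \<epsilon> x *s y) (rep (\<Delta> h)))"
    by (simp add: counit_left)
  also have "\<dots> = lin_ext scale (\<lambda>p. f (case p of (x, y) \<Rightarrow> \<epsilon> x *s y)) (rep (\<Delta> h))"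
    by (rule linear_image_lin_ext[OF assms])
  also have "\<dots> = conv (\<lambda>h. \<epsilon> h *s 1) f h"
    using assms by (simp add: conv_def sweedler_def endo_iff scale_mult_left case_prod_unfold)
  finally show "conv (\<lambda>h. \<epsilon> h *s 1) f h = f h" ..
qed

lemma conv_add_left: "conv (\<lambda>x. f x + g x) k h = conv f k h + conv g k h"
  using lin_ext_add_fun[OF vector_space_axioms, of "\<lambda>(x, y). f x * k y" "\<lambda>(x, y). g x * k y"]
  by (simp add: conv_def sweedler_def case_prod_unfold distrib_right)

lemma conv_sum_right:
  "conv f (\<lambda>h. \<Sum>i\<in>I. c i *s g i h) h = (\<Sum>i\<in>I. c i *s conv f (g i) h)"
  unfolding conv_def sweedler_def lin_ext_def
  by (simp add: case_prod_unfold sum_distrib_left scale_mult_right scale_sum_right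
      sum.swap[of _ I] mult.commute)

text \<open>Both sides are the trilinear map \<open>f u * g v * k w\<close> summed over the two
  formal sums that \<open>coassoc\<close> identifies.\<close>

lemma conv_assoc:
  assumes "endo f" "endo g" "endo k"
  shows "conv (conv f g) k = conv f (conv g k)"
proof
  fix h
  note vs = vector_space_axioms
  let ?F = "lin_ext scale (\<lambda>(u, v, w). f u * g v * k w)"
  have mult_left: "endo (\<lambda>x. a * x)" and mult_right: "endo (\<lambda>x. x * a)" for a
    by (simp_all add: endo_iff algebra_simps scale_mult_left scale_mult_right)
  have l: "conv f g x * k y =
      ?F (lin_ext free_scale (\<lambda>(u, v). gen (u, v, y)) (rep (\<Delta> x)))" for x y
    unfolding conv_def sweedler_def lin_ext_compose[OF vs]
      linear_image_lin_ext[OF mult_right]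
    by (simp add: case_prod_unfold lin_ext_gen[OF vs])
  have r: "f x * conv g k y =
      ?F (lin_ext free_scale (\<lambda>(u, v). gen (x, u, v)) (rep (\<Delta> y)))" for x y
    unfolding conv_def sweedler_def lin_ext_compose[OF vs]
      linear_image_lin_ext[OF mult_left]
    by (simp add: case_prod_unfold lin_ext_gen[OF vs] mult.assoc)
  have "?F (lin_ext free_scale
         (\<lambda>(x, y). lin_ext free_scale (\<lambda>(u, v). gen (u, v, y)) (rep (\<Delta> x))) (rep (\<Delta> h)) -
        lin_ext free_scale
         (\<lambda>(x, y). lin_ext free_scale (\<lambda>(u, v). gen (x, u, v)) (rep (\<Delta> y))) (rep (\<Delta> h))) = 0"
    by (rule lin_ext_tensor3_null[OF vs, where T = "\<lambda>u v w. f u * g v * k w"])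
      (use assms coassoc in \<open>auto simp: endo_iff algebra_simps scale_mult_left scale_mult_right
        intro: tensor3_eq_imp\<close>)
  then show "conv (conv f g) k h = conv f (conv g k) h"
    unfolding conv_def[of "conv f g"] conv_def[of f "conv g k"] sweedler_def l r
      lin_ext_diff[OF vs]
    by (simp add: case_prod_unfold lin_ext_compose[OF vs])
qed

lemma conv_pow_add:
  assumes "endo f" shows "conv_pow f (m + n) = conv (conv_pow f m) (conv_pow f n)"
  using assms by (induction m) (simp_all add: conv_unit_left endo_conv_pow conv_assoc)

lemma conv_pow_mult:
  assumes "endo f" shows "conv_pow f (m * n) = conv_pow (conv_pow f m) n"
  by (induction n) (simp_all add: conv_pow_add[OF assms])

text \<open>One summand is the unit of convolution and so commutes with \<open>f\<close>; the usual
  induction by Pascal's rule applies.\<close>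

lemma conv_pow_binomial:
  assumes "endo f"
  shows "conv_pow (\<lambda>h. \<epsilon> h *s 1 + f h) m h = (\<Sum>i\<le>m. of_nat (m choose i) *s conv_pow f i h)"
proof (induction m arbitrary: h)
  case (Suc m)
  let ?u = "\<lambda>h. \<epsilon> h *s 1 + f h"
  let ?P = "conv_pow ?u m"
  have "endo ?u"
    using assms endo_unit by (simp add: endo_iff algebra_simps)
  then have "conv_pow ?u (Suc m) h = ?P h + conv f ?P h"
    by (simp add: conv_add_left conv_unit_left endo_conv_pow)
  also have "\<dots> = (\<Sum>i\<le>m. of_nat (m choose i) *s conv_pow f i h)
      + (\<Sum>i\<le>m. of_nat (m choose i) *s conv_pow f (Suc i) h)"
    unfolding Suc.IH[abs_def] conv_sum_right by simp
  \<comment> \<open>The added term has coefficient \<open>m choose Suc m = 0\<close>; it gives both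
    sums matching ranges after the index shift.\<close>
  also have "(\<Sum>i\<le>m. of_nat (m choose i) *s conv_pow f i h)
      = (\<Sum>i\<le>Suc m. of_nat (m choose i) *s conv_pow f i h)"
    by (simp add: binomial_eq_0)
  also have "\<dots> + (\<Sum>i\<le>m. of_nat (m choose i) *s conv_pow f (Suc i) h)
      = (\<Sum>i\<le>Suc m. of_nat (Suc m choose i) *s conv_pow f i h)"
    unfolding sum.atMost_Suc_shift
    by (simp add: scale_left_distrib sum.distrib)
  finally show ?case .
qed simp

text \<open>In the step, the left factor \<open>f\<close> kills the coradical and the right factor
  \<open>conv_pow f (Suc m)\<close> kills \<open>coradical_filtration m\<close> by
  induction.\<close>

lemma conv_pow_vanishes_on_filtration:
  assumes "endo f" "\<And>x. x \<in> coradical \<Longrightarrow> f x = 0" "h \<in> coradical_filtration m"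
  shows "conv_pow f (Suc m) h = 0"
  using assms(3)
proof (induction m arbitrary: h)
  case 0
  \<comment> \<open>The first power unfolds to \<open>f\<close> convolved with the unit on the
    right, which \<open>counit_right\<close> reduces to \<open>f\<close>.\<close>
  have "conv_pow f (Suc 0) h = sweedler scale (\<lambda>x y. f x * (\<epsilon> y *s 1)) h"
    by (simp add: conv_def)
  also have "\<dots> = lin_ext scale (\<lambda>p. f (case p of (x, y) \<Rightarrow> \<epsilon> y *s x)) (rep (\<Delta> h))"
    using assms(1)
    by (simp add: sweedler_def endo_iff scale_mult_right case_prod_unfold)
  also have "\<dots> = f h"
    unfolding linear_image_lin_ext[OF assms(1), symmetric] by (simp add: counit_right)
  finally show ?case using 0 assms(2) by simp
next
  case (Suc m)
  show ?case
    unfolding conv_pow.simps(2)[of f "Suc m"] conv_def[of f "conv_pow f (Suc m)"]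
    by (rule sweedler_vanishes_on_filtration[OF vector_space_axioms _ Suc.prems])
      (use Suc.IH assms in \<open>auto intro!: bilinear_mult endo_conv_pow simp del: conv_pow.simps(2)\<close>)
qed

lemma conv_pow_zero_mono:
  assumes "\<And>h. conv_pow f m h = 0" "m \<le> n"
  shows "conv_pow f n h = 0"
  using assms(2)
proof (induction n arbitrary: h rule: dec_induct)
  case (step n)
  then have "conv_pow f n = (\<lambda>h. 0)" by auto
  then show ?case
    by (simp add: conv_def sweedler_def lin_ext_def case_prod_unfold)
qed (rule assms(1))

end

text \<open>With \<open>q = p ^ k\<close>, the product of \<open>i\<close> and
  \<open>q choose i\<close> is a multiple of \<open>q\<close>. Were \<open>p\<close> not a divisor
  of the coefficient, \<open>q\<close> would divide \<open>i\<close>, which is too small.\<close>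

lemma prime_dvd_prime_power_choose:
  fixes p k i :: nat
  assumes "prime p" "0 < i" "i < p ^ k"
  shows "p dvd (p ^ k choose i)"
proof (rule ccontr)
  assume "\<not> ?thesis"
  then have "coprime (p ^ k) (p ^ k choose i)"
    using assms(1) by (simp add: prime_imp_coprime)
  moreover have "p ^ k dvd (p ^ k choose i) * i"
    using times_binomial_minus1_eq[OF assms(2), of "p ^ k"] by (metis dvd_triv_left mult.commute)
  ultimately have "p ^ k dvd i" by (simp add: coprime_dvd_mult_right_iff)
  then show False using assms(2,3) by (simp add: nat_dvd_not_less)
qed

section \<open>Exponents\<close>

context bialgebra
begin

lemma grouplike_one: "grouplike 1"
  by (simp add: grouplike_def counit_one comult_one)

text \<open>Multiplicativity of \<open>\<Delta>\<close> is stated through representatives, so these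
  are replaced by pure tensors: first for \<open>h\<close> in the inner sum, then for
  \<open>g\<close> in the outer one. Multiplication by fixed elements is bilinear modulo
  \<open>tensor_null\<close>.\<close>

lemma grouplike_mult:
  assumes g: "grouplike g" and h: "grouplike h"
  shows "grouplike (g * h)"
proof -
  note vs = free.vector_space_axioms
  have base: "gen (u + u', v) - gen (u, v) - gen (u', v) \<in> tensor_null"
      "gen (u, v + v') - gen (u, v) - gen (u, v') \<in> tensor_null"
      "gen (c *s u, v) - free_scale c (gen (u, v)) \<in> tensor_null"
      "gen (u, c *s v) - free_scale c (gen (u, v)) \<in> tensor_null" for u u' v v' c
    unfolding tensor_null_def by (rule free.span_base, blast)+
  have left: "bilinear_mod free_scale tensor_null (\<lambda>u v. gen (x * u, y * v))" for x y
    by (simp add: bilinear_mod_def distrib_left scale_mult_right base)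
  have right: "bilinear_mod free_scale tensor_null (\<lambda>u v. gen (u * x, v * y))" for x y
    by (simp add: bilinear_mod_def distrib_right scale_mult_left base)
  let ?F = "\<lambda>x y. lin_ext free_scale (\<lambda>(u, v). gen (x * u, y * v)) (rep (\<Delta> h))"
  let ?G = "\<lambda>x y. gen (x * h, y * h) :: 'h \<times> 'h \<Rightarrow>\<^sub>0 'k"
  have diff: "rep (\<Delta> a) - gen (a, a) \<in> tensor_null" if "grouplike a" for a
    using that rep_tensor_diff[of "gen (a, a)"] by (simp add: grouplike_def)
  have "?F x y - ?G x y \<in> tensor_null" for x y
    using lin_ext_tensor_null[OF vs subspace_tensor_null left diff[OF h], of x y]
    by (simp add: lin_ext_diff[OF vs] lin_ext_gen[OF vs])
  then have "lin_ext free_scale (\<lambda>(x, y). ?F x y) (rep (\<Delta> g))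
      - lin_ext free_scale (\<lambda>(x, y). ?G x y) (rep (\<Delta> g)) \<in> tensor_null"
    by (intro lin_ext_diff_fun_mem subspace_tensor_null vs) auto
  moreover have "lin_ext free_scale (\<lambda>(x, y). ?G x y) (rep (\<Delta> g)) - ?G g g \<in> tensor_null"
    using lin_ext_tensor_null[OF vs subspace_tensor_null right diff[OF g], of h h]
    by (simp add: lin_ext_diff[OF vs] lin_ext_gen[OF vs])
  ultimately have "lin_ext free_scale (\<lambda>(x, y). ?F x y) (rep (\<Delta> g)) - ?G g g \<in> tensor_null"
    using free.subspace_add[OF subspace_tensor_null] by fastforce
  then show ?thesis
    using g h by (simp add: grouplike_def comult_mult counit_mult tensor_eq_iff)
qed

lemma grouplike_power: "grouplike g \<Longrightarrow> grouplike (g ^ n)"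
  by (induction n) (simp_all add: grouplike_one grouplike_mult)

lemma endo_hopf_power: "endo (hopf_power n)"
proof -
  have "endo (\<lambda>x. x)" by (simp add: endo_iff)
  moreover have "hopf_power n = conv_pow (\<lambda>x. x) n" by (auto simp: hopf_power_eq_conv_pow)
  ultimately show ?thesis by (simp add: endo_conv_pow)
qed

lemma hopf_power_grouplike:
  assumes "grouplike g" shows "hopf_power n g = g ^ n"
proof (induction n)
  case (Suc n)
  have "bilinear scale (\<lambda>x y. x * hopf_power n y)"
    by (intro bilinear_mult endo_hopf_power) (simp add: endo_iff)
  from sweedler_grouplike[OF vector_space_axioms this assms] Suc show ?case
    by (simp add: sweedler_def)
qed (use assms in \<open>simp add: grouplike_def\<close>)

end

section \<open>Finiteness of the exponent of the coradical\<close>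

context hopf_algebra
begin

lemma grouplike_antipode:
  assumes "grouplike g" shows "S g * g = 1"
proof -
  have "bilinear scale (\<lambda>x y. S x * y)"
    by (rule bilinear_mult) (use antipode_linear in \<open>simp_all add: endo_iff\<close>)
  from sweedler_grouplike[OF vector_space_axioms this assms] show ?thesis
    using antipode_left[of g] assms by (simp add: sweedler_def grouplike_def)
qed

text \<open>The powers of \<open>g\<close> are group-like, hence finitely many, so two of them
  coincide; the antipode allows the smaller power to be cancelled.\<close>

lemma grouplike_finite_order:
  assumes "finite_dimensional" "grouplike g"
  shows "\<exists>n>0. g ^ n = 1"
proof -
  have cancel: "x = y" if "g ^ i * x = g ^ i * y" for i x y
    using that
  proof (induction i)
    case (Suc i)
    have "S g * g * (g ^ i * x) = S g * g * (g ^ i * y)"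
      using Suc.prems by (simp add: mult.assoc)
    then show ?case using Suc.IH by (simp add: grouplike_antipode[OF assms(2)])
  qed simp
  have "range (\<lambda>n. g ^ n) \<subseteq> {g. grouplike g}"
    using grouplike_power[OF assms(2)] by auto
  then have "finite (range (\<lambda>n. g ^ n))"
    using grouplikes_finite[OF assms(1)] finite_subset by blast
  then have "\<not> inj (\<lambda>n::nat. g ^ n)"
    using finite_imageD infinite_UNIV_nat by blast
  then obtain i j where "i < j" "g ^ i = g ^ j"
    unfolding inj_on_def by (metis linorder_neqE_nat)
  then have "g ^ i * g ^ (j - i) = g ^ i * 1"
    using \<open>i < j\<close> by (metis power_add le_add_diff_inverse less_imp_le mult_1_right)
  with cancel \<open>i < j\<close> show ?thesis by (intro exI[of _ "j - i"]) auto
qed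

lemma coradical_exponent_exists:
  assumes "finite_dimensional" "pointed"
  shows "\<exists>n>0. \<forall>h\<in>coradical. hopf_power n h = \<epsilon> h *s 1"
proof -
  obtain r where r: "\<And>g. grouplike g \<Longrightarrow> r g > 0 \<and> g ^ r g = 1"
    using grouplike_finite_order[OF assms(1)] by metis
  \<comment> \<open>A common multiple of the chosen exponents \<open>r g\<close>. Both sides of the
    goal are linear, so agreement on group-likes extends to their span.\<close>
  define n where "n = (\<Prod>g | grouplike g. r g :: nat)"
  have "g ^ n = 1" if "grouplike g" for g
  proof -
    have "r g dvd n"
      unfolding n_def using grouplikes_finite[OF assms(1)] that by (intro dvd_prodI) auto
    then show ?thesis using r[OF that] by (auto simp: power_mult)
  qed
  then have vanish: "hopf_power n g - \<epsilon> g *s 1 = 0" if "grouplike g" for g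
    using that hopf_power_grouplike by (simp add: grouplike_def)
  have lin: "endo (\<lambda>h. hopf_power n h - \<epsilon> h *s 1)"
    using endo_hopf_power[of n] endo_unit
    by (simp add: endo_iff scale_right_diff_distrib)
  have "hopf_power n h = \<epsilon> h *s 1" if "h \<in> coradical" for h
    using linear_vanishes_on_span[OF lin, of h "{g. grouplike g}"] vanish that
      pointed_coradical_subset_span_grouplike[OF assms(2)] by auto
  moreover have "n > 0" unfolding n_def using r by (intro prod_pos) auto
  ultimately show ?thesis by blast
qed

end

section \<open>Passing from the coradical to the whole bialgebra\<close>

context bialgebra
begin

lemma hopf_power_trivial_if_coradical_trivial:
  assumes "prime CHAR('k)" "coradical_filtration n = UNIV" "n < CHAR('k) ^ k"
    and d: "\<And>h. h \<in> coradical \<Longrightarrow> hopf_power d h = \<epsilon> h *s 1"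
  shows "hopf_power (d * CHAR('k) ^ k) h = \<epsilon> h *s 1"
proof -
  let ?q = "CHAR('k) ^ k"
  define f where "f = (\<lambda>h. hopf_power d h - \<epsilon> h *s 1)"
  have f: "endo f"
    using endo_hopf_power[of d] endo_unit
    by (simp add: f_def endo_iff scale_right_diff_distrib)
  have zero: "conv_pow f ?q h = 0" for h
  \<comment> \<open>The filtration exhausts the space at \<open>n\<close>, so power
    \<open>Suc n\<close> of \<open>f\<close> is zero, and \<open>Suc n \<le> ?q\<close>.\<close>
  proof (rule conv_pow_zero_mono[of f "Suc n"])
    show "conv_pow f (Suc n) h = 0" for h
      by (rule conv_pow_vanishes_on_filtration[OF f]) (use d assms(2) in \<open>auto simp: f_def\<close>)
  qed (use assms(3) in simp)
  have "endo (\<lambda>x. x)" by (simp add: endo_iff)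
  then have "hopf_power (d * ?q) h = conv_pow (conv_pow (\<lambda>x. x) d) ?q h"
    by (simp add: hopf_power_eq_conv_pow conv_pow_mult)
  also have "conv_pow (\<lambda>x. x) d = (\<lambda>h. \<epsilon> h *s 1 + f h)"
    by (auto simp: f_def hopf_power_eq_conv_pow)
  also have "conv_pow \<dots> ?q h = (\<Sum>i\<le>?q. of_nat (?q choose i) *s conv_pow f i h)"
    by (rule conv_pow_binomial[OF f])
  \<comment> \<open>Inner coefficients vanish in the field by divisibility, and the top term
    vanishes by \<open>zero\<close>.\<close>
  also have "\<dots> = (\<Sum>i\<le>?q. if i = 0 then \<epsilon> h *s 1 else 0)"
  proof (rule sum.cong[OF refl])
    fix i assume "i \<in> {..?q}"
    then consider "i = 0" | "0 < i" "i < ?q" | "0 < i" "i = ?q" by fastforce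
    then show "of_nat (?q choose i) *s conv_pow f i h = (if i = 0 then \<epsilon> h *s 1 else 0)"
    proof cases
      case 2
      then have "of_nat (?q choose i) = (0 :: 'k)"
        using prime_dvd_prime_power_choose[OF assms(1)] by (simp add: of_nat_eq_0_iff_char_dvd)
      then show ?thesis using 2 by simp
    next
      case 3
      then show ?thesis using zero by auto
    qed simp
  qed
  finally show ?thesis by simp
qed

end

theorem theorem5p1:
  fixes scale :: "'k::field \<Rightarrow> 'h::ring_1 \<Rightarrow> 'h"
    and \<Delta> :: "'h \<Rightarrow> ('h \<times> 'h \<Rightarrow>\<^sub>0 'k) set" and \<epsilon> :: "'h \<Rightarrow> 'k" and S :: "'h \<Rightarrow> 'h"
    and p n :: nat
  assumes "hopf_algebra scale \<Delta> \<epsilon> S"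
    and "tensor_vector_space.finite_dimensional scale"
    and "coalgebra.pointed scale \<Delta>"
    and "CHAR('k) = p" and "p > 0"
    and "n > 0" and "coalgebra.coradical_filtration scale \<Delta> n = UNIV"
  shows "\<exists>d. bialgebra.exponent scale \<Delta> \<epsilon> (coalgebra.coradical_filtration scale \<Delta> 0) = enat d \<and>
    bialgebra.exponent scale \<Delta> \<epsilon> UNIV \<le> enat (d * p ^ (nat \<lfloor>log (real p) (real n)\<rfloor> + 1))"
proof -
  interpret hopf_algebra scale \<Delta> \<epsilon> S by fact
  have prime: "prime CHAR('k)"
    using assms(4,5) by (intro prime_CHAR_semidom) simp
  let ?k = "nat \<lfloor>log (real p) (real n)\<rfloor> + 1"
  let ?Q = "\<lambda>m. m > 0 \<and> (\<forall>h\<in>coradical. hopf_power m h = scale (\<epsilon> h) 1)"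
  let ?R = "\<lambda>m. m > 0 \<and> (\<forall>h\<in>UNIV. hopf_power m h = scale (\<epsilon> h) 1)"
  have ex: "\<exists>m. ?Q m"
    using coradical_exponent_exists[OF assms(2,3)] by blast
  define d where "d = (LEAST m. ?Q m)"
  have d: "?Q d" unfolding d_def using ex by (rule LeastI_ex)
  have expd: "exponent (coradical_filtration 0) = enat d"
    using ex by (auto simp: exponent_def d_def)
  have p: "real p > 1" using prime assms(4) prime_gt_1_nat by auto
  \<comment> \<open>The \<open>+ 1\<close> after the floor makes this strict, which yields the
    required \<open>n < p ^ ?k\<close>.\<close>
  have "log (real p) (real n) < real ?k" by linarith
  then have "real n < real p powr real ?k"
    using p assms(6) by (subst (asm) log_less_iff) auto
  then have "n < p ^ ?k"
    using p by (simp only: powr_realpow of_nat_less_iff flip: of_nat_power)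
  then have R: "?R (d * p ^ ?k)"
    using hopf_power_trivial_if_coradical_trivial[OF prime assms(7), of ?k d] d assms(4,5) by auto
  \<comment> \<open>The witness shows that the exponent is finite and, by minimality, bounds
    it.\<close>
  then have "exponent UNIV = enat (LEAST m. ?R m)"
    unfolding exponent_def by (subst if_P) blast+
  moreover have "(LEAST m. ?R m) \<le> d * p ^ ?k"
    using R by (rule Least_le)
  ultimately show ?thesis using expd by (intro exI[of _ d]) simp
qed

end
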